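(* For any finite poset $P$, the order complex of $I_2(P)$ (that is, the multiset of the order complexes of the subposets forming the interval transform of the second kind $I_2(P)$) is a Tchebyshev triangulation of the second kind of the order complex $\triangle(P)$, associated to the Tchebyshev triangulation of the first kind that is the order complex $\triangle(I(P))$.
   Context: An interval $[u,v]$ of a poset $P$ (for $u\le v$) is the set of all $w\in P$ with $u\le w\le v$. $I(P)$ is the set of all (nonempty) intervals of $P$, ordered by inclusion. The order complex $\triangle(Q)$ of a finite poset $Q$ is the simplicial complex on the vertex set $Q$ whose faces are the increasing chains of $Q$. The interval transform of the second kind $I_2(P)$ is the multiset of subposets of $I(P)$ defined as follows: for each $x\in P$ we take the subposet of $I(P)$ formed by all elements $[y,z]\in I(P)$ containing $[x,x]$. The link of a face $\tau$ in a simplicial complex $\triangle$ is the set of faces $\operatorname{link}_{\triangle}(\tau)=\{\sigma-\tau:\ \sigma\in\triangle,\ \tau\subseteq\sigma\}$. A Tchebyshev triangulation (of the first kind) $T(\triangle)$ of a finite simplicial complex $\triangle$ is obtained as follows. Number the edges $e_1,\ldots,e_m$ of $\triangle$ in some order, and associate to each edge $e_i=\{u_i,v_i\}$ a new vertex $w_i$, its midpoint. Set $\triangle_0=\triangle$. For $i\ge 1$, $\triangle_i$ is obtained from $\triangle_{i-1}$ by a stellar subdivision of the edge $e_i$: the edge $e_i$ is replaced by the path $L_i$ with vertex set $\{u_i,v_i,w_i\}$ and edge set $\{\{u_i,w_i\},\{w_i,v_i\}\}$, and the family of faces $\{e_i\cup\tau:\ \tau\in\operatorname{link}_{\triangle_{i-1}}(e_i)\}$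 containing $e_i$ is replaced by the family of faces $\sigma'\cup\tau$, where $\sigma'\in L_i$ and $\tau\in\operatorname{link}_{\triangle_{i-1}}(e_i)$. The complex $\triangle_m$ is $T(\triangle)$. The corresponding Tchebyshev triangulation of the second kind $U(\triangle)$ is the collection (multiset) of the links $\operatorname{link}_{T(\triangle)}(\{v\})$ for all vertices $v$ of the original complex $\triangle$. The complex $\triangle(I(P))$ is regarded as a Tchebyshev triangulation of $\triangle(P)$ by identifying the vertex $[u,u]$ with the vertex $u$ of $\triangle(P)$ and, for $u<v$, the vertex $[u,v]$ with the midpoint of the edge $\{u,v\}$ of $\triangle(P)$, the midpoints $[u_1,v_1],[u_2,v_2],\ldots$ being numbered in such an order that $i<j$ holds whenever $[u_i,v_i]$ properly contains $[u_j,v_j]$.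
   Formalization: In the definition of I_2(P), "containing [x,x]" is taken as proper containment, so [x,x] itself is excluded; with [x,x] included the claim fails for every nonempty P, since a vertex never lies in its own link. *)

theory Defs
  imports Main "HOL-Library.Multiset"
begin

section \<open>Posets of intervals\<close>

text \<open>A poset is a carrier \<open>P\<close> with a relation \<open>r\<close> such that \<^term>\<open>partial_order_on P r\<close>.
  Subposets of a fixed poset are represented by their carriers.\<close>

definition interval :: "'a set \<Rightarrow> 'a rel \<Rightarrow> 'a \<Rightarrow> 'a \<Rightarrow> 'a set" where
  "interval P r u v = {w \<in> P. (u, w) \<in> r \<and> (w, v) \<in> r}"

definition intervals :: "'a set \<Rightarrow> 'a rel \<Rightarrow> 'a set set" where
  "intervals P r = {interval P r u v | u v. u \<in> P \<and> v \<in> P \<and> (u, v) \<in> r}"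

definition inclusion :: "'a set rel" where
  "inclusion = {(J, K). J \<subseteq> K}"

text \<open>The faces are the chains of the subposet with carrier \<open>Q\<close>, the empty chain included.
  The definition is meant for finite \<open>Q\<close>.\<close>

definition order_complex :: "'a set \<Rightarrow> 'a rel \<Rightarrow> 'a set set" where
  "order_complex Q r = {\<sigma>. \<sigma> \<subseteq> Q \<and> \<sigma> \<in> Chains r}"

text \<open>``Containing \<open>[x,x]\<close>'' is proper containment. If \<open>[x,x]\<close> itself were admitted, it would be
  the least element of the subposet, whose order complex would be a cone with apex \<open>[x,x]\<close>,
  whereas the link of a vertex never contains that vertex; see \<open>improper_containment_fails\<close> below.
  The multiset has one member for each \<open>x \<in> P\<close>; different \<open>x\<close> may give equal subposets.\<close>

definition interval_transform2 :: "'a set \<Rightarrow> 'a rel \<Rightarrow> 'a set set multiset" where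
  "interval_transform2 P r =
     image_mset (\<lambda>x. {J \<in> intervals P r. interval P r x x \<subset> J}) (mset_set P)"


section \<open>Tchebyshev triangulations\<close>

definition finite_complex :: "'v set set \<Rightarrow> bool" where
  "finite_complex \<Delta> \<longleftrightarrow>
     finite \<Delta> \<and> {} \<in> \<Delta> \<and> (\<forall>\<sigma>\<in>\<Delta>. finite \<sigma> \<and> (\<forall>\<tau>. \<tau> \<subseteq> \<sigma> \<longrightarrow> \<tau> \<in> \<Delta>))"

definition vertices :: "'v set set \<Rightarrow> 'v set" where
  "vertices \<Delta> = \<Union>\<Delta>"

definition edges :: "'v set set \<Rightarrow> 'v set set" where
  "edges \<Delta> = {e \<in> \<Delta>. card e = 2}"

definition link :: "'v set set \<Rightarrow> 'v set \<Rightarrow> 'v set set" where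
  "link \<Delta> \<tau> = {\<sigma> - \<tau> | \<sigma>. \<sigma> \<in> \<Delta> \<and> \<tau> \<subseteq> \<sigma>}"

text \<open>The path with vertices \<open>u\<close>, \<open>w\<close>, \<open>v\<close> (where \<open>e = {u, v}\<close>) and edges \<open>{u, w}\<close>, \<open>{w, v}\<close>,
  as a simplicial complex.\<close>

definition edge_path :: "'v set \<Rightarrow> 'v \<Rightarrow> 'v set set" where
  "edge_path e w = (\<Union>x\<in>e. Pow {x, w})"

definition stellar_subdivision :: "'v set \<Rightarrow> 'v \<Rightarrow> 'v set set \<Rightarrow> 'v set set" where
  "stellar_subdivision e w \<Delta> =
     (\<Delta> - {e \<union> \<tau> | \<tau>. \<tau> \<in> link \<Delta> e}) \<union>
     {\<sigma>' \<union> \<tau> | \<sigma>' \<tau>. \<sigma>' \<in> edge_path e w \<and> \<tau> \<in> link \<Delta> e}"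

text \<open>A list of pairs (edge, midpoint) fixes both the order of the edges and the new vertices.\<close>

definition edge_numbering :: "'v set set \<Rightarrow> ('v set \<times> 'v) list \<Rightarrow> bool" where
  "edge_numbering \<Delta> ews \<longleftrightarrow>
     distinct (map fst ews) \<and> set (map fst ews) = edges \<Delta> \<and>
     distinct (map snd ews) \<and> set (map snd ews) \<inter> vertices \<Delta> = {}"

definition tchebyshev_first :: "'v set set \<Rightarrow> ('v set \<times> 'v) list \<Rightarrow> 'v set set \<Rightarrow> bool" where
  "tchebyshev_first \<Delta> ews T \<longleftrightarrow>
     finite_complex \<Delta> \<and> edge_numbering \<Delta> ews \<and>
     T = fold (\<lambda>(e, w). stellar_subdivision e w) ews \<Delta>"

definition vertex_links :: "'v set set \<Rightarrow> 'v set set \<Rightarrow> 'v set set multiset" where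
  "vertex_links \<Delta> T = image_mset (\<lambda>v. link T {v}) (mset_set (vertices \<Delta>))"

text \<open>\<open>U\<close> is the triangulation of the second kind of \<open>\<Delta>\<close> associated to the triangulation \<open>T\<close> of the
  first kind, which is obtained from the numbering \<open>ews\<close>.\<close>

definition tchebyshev_second ::
    "'v set set \<Rightarrow> ('v set \<times> 'v) list \<Rightarrow> 'v set set \<Rightarrow> 'v set set multiset \<Rightarrow> bool" where
  "tchebyshev_second \<Delta> ews T U \<longleftrightarrow> tchebyshev_first \<Delta> ews T \<and> U = vertex_links \<Delta> T"


section \<open>The order complex of the intervals as a triangulation\<close>

text \<open>The order complex of \<open>P\<close>, with each vertex \<open>u\<close> renamed to \<open>[u,u]\<close>.\<close>

definition embedded_order_complex :: "'a set \<Rightarrow> 'a rel \<Rightarrow> 'a set set set" where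
  "embedded_order_complex P r = (\<lambda>\<sigma>. (\<lambda>u. interval P r u u) ` \<sigma>) ` order_complex P r"

definition interval_edge :: "'a set \<Rightarrow> 'a rel \<Rightarrow> 'a \<times> 'a \<Rightarrow> 'a set set \<times> 'a set" where
  "interval_edge P r = (\<lambda>(u, v). ({interval P r u u, interval P r v v}, interval P r u v))"

text \<open>The admissible numberings \<open>[u\<^sub>1,v\<^sub>1], [u\<^sub>2,v\<^sub>2], \<dots>\<close> of the intervals with \<open>u < v\<close>: an interval
  comes before the intervals properly contained in it.\<close>

definition interval_numbering :: "'a set \<Rightarrow> 'a rel \<Rightarrow> ('a \<times> 'a) list \<Rightarrow> bool" where
  "interval_numbering P r uvs \<longleftrightarrow>
     distinct uvs \<and> set uvs = {(u, v) \<in> r. u \<noteq> v} \<and>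
     (\<forall>i<length uvs. \<forall>j<length uvs.
        interval P r (fst (uvs ! j)) (snd (uvs ! j)) \<subset> interval P r (fst (uvs ! i)) (snd (uvs ! i))
        \<longrightarrow> i < j)"

lemma improper_containment_fails:
  assumes "finite P" "partial_order_on P r" "P \<noteq> {}"
  shows "image_mset (\<lambda>x. order_complex {J \<in> intervals P r. interval P r x x \<subseteq> J} inclusion)
           (mset_set P)
         \<noteq> vertex_links (embedded_order_complex P r) (order_complex (intervals P r) inclusion)"
    (is "?A \<noteq> vertex_links ?D ?T")
proof
  assume eq: "?A = vertex_links ?D ?T"
  have single: "interval P r u u = {u}" if "u \<in> P" for u
    using assms(2) that
    by (auto simp: interval_def partial_order_on_def preorder_on_def refl_on_def antisym_def)
  obtain x where x: "x \<in> P" using assms(3) by blast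
  let ?K = "order_complex {J \<in> intervals P r. interval P r x x \<subseteq> J} inclusion"
  have "(x, x) \<in> r"
    using assms(2) x by (simp add: partial_order_on_def preorder_on_def refl_on_def)
  then have face: "{{x}} \<in> ?K"
  proof -
    have "interval P r x x \<in> intervals P r"
      unfolding intervals_def using x \<open>(x, x) \<in> r\<close> by blast
    then show ?thesis
      by (simp add: single[OF x] order_complex_def Chains_def inclusion_def)
  qed
  have "?K \<in># ?A" using x assms(1) by auto
  then have "?K \<in># vertex_links ?D ?T" using eq by simp
  then have "?K \<in> (\<lambda>v. link ?T {v}) ` set_mset (mset_set (vertices ?D))"
    unfolding vertex_links_def set_image_mset .
  then obtain v where v: "v \<in># mset_set (vertices ?D)" and K: "?K = link ?T {v}"
    by (rule imageE)
  have "v \<in> vertices ?D"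
    using v by (cases "finite (vertices ?D)") simp_all
  then obtain y where "y \<in> P" "v = interval P r y y"
    unfolding vertices_def embedded_order_complex_def order_complex_def by blast
  then have y: "v = {y}" using single by simp
  have "{{x}} \<in> link ?T {{y}}" using face K y by simp
  then obtain \<sigma> where \<sigma>: "{{x}} = \<sigma> - {{y}}" "\<sigma> \<in> ?T" "{y} \<in> \<sigma>"
    unfolding link_def by blast
  have "{x} \<in> \<sigma>" and "x \<noteq> y" using \<sigma>(1) by blast+
  moreover have "({x}, {y}) \<in> inclusion \<or> ({y}, {x}) \<in> inclusion"
    using \<sigma>(2,3) \<open>{x} \<in> \<sigma>\<close> unfolding order_complex_def Chains_def by blast
  ultimately show False by (simp add: inclusion_def)
qed

end

theory Submission
  imports Defs
begin

text \<open>All intermediate complexes are clique (flag) complexes, and the stellar subdivision of an edge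
  \<open>{u, v}\<close> of a clique complex is again one: the edge is removed from the graph and the midpoint is
  joined to the common neighbours of \<open>u\<close> and \<open>v\<close>. Once the edges with midpoints in \<open>S\<close> have been
  subdivided, two vertices are adjacent iff they are comparable under inclusion or are singletons
  \<open>{a}\<close>, \<open>{b}\<close> with \<open>a < b\<close> and \<open>[a,b]\<close> not yet in \<open>S\<close>. As larger intervals come first, the common
  neighbours of \<open>{u}\<close> and \<open>{v}\<close> are then exactly the vertices comparable with \<open>[u,v]\<close>.\<close>

section \<open>Clique complexes and stellar subdivision\<close>

text \<open>\<open>R\<close> is adjacency made reflexive: the condition includes
  \<open>x = y\<close>, just as \<open>Chains\<close> compares an element with itself.\<close>

definition clique_complex :: "'v set \<Rightarrow> ('v \<Rightarrow> 'v \<Rightarrow> bool) \<Rightarrow> 'v set set" where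
  "clique_complex V R = {\<sigma>. \<sigma> \<subseteq> V \<and> (\<forall>x\<in>\<sigma>. \<forall>y\<in>\<sigma>. R x y)}"

lemma link_clique_complex_edge:
  assumes "reflp_on V R" and "symp R" and "u \<in> V" "v \<in> V" "R u v"
  shows "link (clique_complex V R) {u, v} =
    {\<tau> \<in> clique_complex V R. u \<notin> \<tau> \<and> v \<notin> \<tau> \<and> (\<forall>x\<in>\<tau>. R x u \<and> R x v)}" (is "_ = ?L")
proof
  show "link (clique_complex V R) {u, v} \<subseteq> ?L"
    by (auto simp: link_def clique_complex_def)
  show "?L \<subseteq> link (clique_complex V R) {u, v}"
  proof
    fix \<tau> assume \<tau>: "\<tau> \<in> ?L"
    have "\<tau> \<union> {u, v} \<in> clique_complex V R"
      using \<tau> assms by (auto simp: clique_complex_def dest: sympD reflp_onD)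
    moreover have "\<tau> = (\<tau> \<union> {u, v}) - {u, v}" using \<tau> by auto
    ultimately show "\<tau> \<in> link (clique_complex V R) {u, v}" unfolding link_def by blast
  qed
qed

text \<open>The faces \<open>e \<union> \<tau>\<close> with \<open>\<tau>\<close> in the link are
  exactly the faces containing \<open>e\<close>, so the removal becomes a filter.\<close>

lemma stellar_subdivision_eq:
  "stellar_subdivision e w \<Delta> =
    {\<sigma> \<in> \<Delta>. \<not> e \<subseteq> \<sigma>} \<union> {\<sigma>' \<union> \<tau> | \<sigma>' \<tau>. \<sigma>' \<in> edge_path e w \<and> \<tau> \<in> link \<Delta> e}"
proof -
  have "{e \<union> \<tau> | \<tau>. \<tau> \<in> link \<Delta> e} = {\<sigma> \<in> \<Delta>. e \<subseteq> \<sigma>}"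
  proof -
    have "e \<union> (\<sigma> - e) = \<sigma>" if "e \<subseteq> \<sigma>" for \<sigma> using that by blast
    then show ?thesis unfolding link_def by (smt (verit) Collect_cong mem_Collect_eq)
  qed
  then show ?thesis unfolding stellar_subdivision_def by auto
qed

text \<open>Dropping the faces through \<open>{u, v}\<close> deletes that edge from the graph. The
  faces put in consist of \<open>w\<close>, at most one of \<open>u\<close> and \<open>v\<close>,
  and a clique of common neighbours, which is what a clique through \<open>w\<close> looks like
  under \<open>R'\<close>.\<close>

lemma stellar_subdivision_clique_complex:
  assumes refl: "reflp_on V R" and sym: "symp R" and sym': "symp R'"
    and uv: "u \<in> V" "v \<in> V" "u \<noteq> v" "R u v" and w: "w \<notin> V" "R' w w"
    and old: "\<And>x y. x \<in> V \<Longrightarrow> y \<in> V \<Longrightarrow> R' x y \<longleftrightarrow> R x y \<and> {x, y} \<noteq> {u, v}"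
    and new: "\<And>x. x \<in> V \<Longrightarrow> R' x w \<longleftrightarrow> R x u \<and> R x v"
  shows "stellar_subdivision {u, v} w (clique_complex V R) = clique_complex (insert w V) R'"
    (is "?S = ?C")
proof -
  have link: "\<tau> \<in> link (clique_complex V R) {u, v} \<longleftrightarrow> \<tau> \<subseteq> V \<and> (\<forall>x\<in>\<tau>. \<forall>y\<in>\<tau>. R x y) \<and>
      u \<notin> \<tau> \<and> v \<notin> \<tau> \<and> (\<forall>x\<in>\<tau>. R x u \<and> R x v)" for \<tau>
    unfolding link_clique_complex_edge[OF refl sym uv(1,2,4)] by (auto simp: clique_complex_def)
  have new': "R' w x \<longleftrightarrow> R x u \<and> R x v" if "x \<in> V" for x
    using new[OF that] sym' by (meson sympD)
  have vu: "R v u" using uv(4) sym by (meson sympD)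
  have sub1: "\<sigma> \<in> ?C" if "\<sigma> \<in> clique_complex V R" "\<not> {u, v} \<subseteq> \<sigma>" for \<sigma>
    using that old unfolding clique_complex_def by (auto simp: doubleton_eq_iff subset_iff)
  have sub2: "\<sigma>' \<union> \<tau> \<in> ?C"
    if \<sigma>': "\<sigma>' \<in> edge_path {u, v} w" and \<tau>: "\<tau> \<in> link (clique_complex V R) {u, v}" for \<sigma>' \<tau>
  proof -
    obtain z where z: "z = u \<or> z = v" "\<sigma>' \<subseteq> {z, w}" using \<sigma>' by (auto simp: edge_path_def)
    have \<tau>V: "\<tau> \<subseteq> V" and \<tau>R: "R x y" "R x u" "R x v" "x \<noteq> u" "x \<noteq> v"
      if "x \<in> \<tau>" "y \<in> \<tau>" for x y
      using \<tau> that unfolding link by auto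
    have zV: "z \<in> V" and zR: "R z u" "R z v" using z uv reflp_onD[OF refl] vu by auto
    let ?N = "insert z \<tau>"
    have NV: "x \<in> V" "R x u" "R x v" if "x \<in> ?N" for x
      using that zV zR \<tau> unfolding link by auto
    have NR: "R' x y" if "x \<in> ?N" "y \<in> ?N" for x y
    proof -
      have "R x y"
        using that \<tau>R z reflp_onD[OF refl zV] sym by (metis insert_iff sympD)
      \<comment> \<open>\<open>\<tau>\<close> avoids both \<open>u\<close> and \<open>v\<close>, and
        \<open>z\<close> is only one of them.\<close>
      moreover have "{x, y} \<noteq> {u, v}"
        using that \<tau>R(4,5) z uv(3) by (metis doubleton_eq_iff insert_iff)
      ultimately show ?thesis using old NV(1) that by blast
    qed
    \<comment> \<open>The largest case, with \<open>w\<close> and an endpoint both added; the given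
      face is a subset of it.\<close>
    have "insert w ?N \<in> ?C"
      using NV NR new new' w unfolding clique_complex_def by auto
    moreover have "\<sigma>' \<union> \<tau> \<subseteq> insert w ?N" using z by auto
    ultimately show ?thesis unfolding clique_complex_def by blast
  qed
  have sup: "\<sigma> \<in> ?S" if \<sigma>: "\<sigma> \<in> ?C" for \<sigma>
  proof -
    have \<sigma>V: "\<sigma> \<subseteq> insert w V" and \<sigma>R: "\<And>x y. x \<in> \<sigma> \<Longrightarrow> y \<in> \<sigma> \<Longrightarrow> R' x y"
      using \<sigma> by (auto simp: clique_complex_def)
    have nuv: "\<not> {u, v} \<subseteq> \<sigma>" using \<sigma>R old[OF uv(1,2)] by auto
    show ?thesis
    proof (cases "w \<in> \<sigma>")
      case False
      then have "\<sigma> \<subseteq> V" using \<sigma>V by blast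
      then have "\<sigma> \<in> clique_complex V R"
        using \<sigma>R old unfolding clique_complex_def by blast
      then show ?thesis using nuv by (simp add: stellar_subdivision_eq)
    next
      case True
      \<comment> \<open>The vertices of \<open>?\<tau>\<close> are adjacent to \<open>w\<close>,
        hence common neighbours of \<open>u\<close> and \<open>v\<close>; the rest fits into the
        path because \<open>u\<close> and \<open>v\<close> do not both occur.\<close>
      let ?\<tau> = "\<sigma> - {u, v, w}" and ?\<sigma>' = "\<sigma> \<inter> {u, v, w}"
      have \<tau>V: "?\<tau> \<subseteq> V" using \<sigma>V by blast
      moreover have "R x y" if "x \<in> ?\<tau>" "y \<in> ?\<tau>" for x y
        using that \<tau>V \<sigma>R[of x y] old[of x y] by blast
      moreover have "R x u \<and> R x v" if "x \<in> ?\<tau>" for x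
        using that \<tau>V \<sigma>R[of x w] new[of x] True by blast
      ultimately have "?\<tau> \<in> link (clique_complex V R) {u, v}" unfolding link by blast
      moreover have "?\<sigma>' \<in> edge_path {u, v} w" using nuv by (auto simp: edge_path_def)
      moreover have "\<sigma> = ?\<sigma>' \<union> ?\<tau>" by blast
      ultimately show ?thesis unfolding stellar_subdivision_eq by blast
    qed
  qed
  show ?thesis
  proof
    show "?S \<subseteq> ?C" using sub1 sub2 by (auto simp: stellar_subdivision_eq)
    show "?C \<subseteq> ?S" using sup by blast
  qed
qed


section \<open>Subdividing the order complex of a poset\<close>

locale finite_poset =
  fixes P :: "'a set" and r :: "'a rel"
  assumes finite: "finite P" and po: "partial_order_on P r"
begin

section \<open>Intervals and their endpoints\<close>

abbreviation I :: "'a \<Rightarrow> 'a \<Rightarrow> 'a set" where "I \<equiv> interval P r"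

definition strict_pairs :: "('a \<times> 'a) set" where
  "strict_pairs = {(u, v) \<in> r. u \<noteq> v}"

lemma carrier: "(u, v) \<in> r \<Longrightarrow> u \<in> P \<and> v \<in> P"
  using po by (auto simp: partial_order_on_def preorder_on_def)

lemma refl: "u \<in> P \<Longrightarrow> (u, u) \<in> r"
  using po by (auto simp: partial_order_on_def preorder_on_def refl_on_def)

lemma trans: "(u, v) \<in> r \<Longrightarrow> (v, w) \<in> r \<Longrightarrow> (u, w) \<in> r"
  using po by (auto simp: partial_order_on_def preorder_on_def dest: transD)

lemma antisym: "(u, v) \<in> r \<Longrightarrow> (v, u) \<in> r \<Longrightarrow> u = v"
  using po by (auto simp: partial_order_on_def dest: antisymD)

lemma finite_strict_pairs: "finite strict_pairs"
  by (rule finite_subset[of _ "P \<times> P"]) (auto simp: strict_pairs_def finite carrier)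

lemma interval_self: "u \<in> P \<Longrightarrow> I u u = {u}"
  by (auto simp: interval_def refl antisym)

lemma endpoints_in_interval: "(u, v) \<in> r \<Longrightarrow> u \<in> I u v \<and> v \<in> I u v"
  by (auto simp: interval_def refl carrier)

text \<open>The hypothesis puts both endpoints into \<open>I u v\<close>, and they decide the
  inclusion. An empty \<open>I u v\<close> would lie in every interval.\<close>

lemma interval_subset_iff:
  assumes "(u, v) \<in> r"
  shows "I u v \<subseteq> I a b \<longleftrightarrow> (a, u) \<in> r \<and> (v, b) \<in> r"
proof
  assume "I u v \<subseteq> I a b"
  then have "u \<in> I a b" "v \<in> I a b" using endpoints_in_interval[OF assms] by auto
  then show "(a, u) \<in> r \<and> (v, b) \<in> r" by (auto simp: interval_def)
next
  assume "(a, u) \<in> r \<and> (v, b) \<in> r"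
  then show "I u v \<subseteq> I a b" by (auto simp: interval_def intro: trans[of a u] trans[of _ v b])
qed

lemma interval_inject:
  assumes "(u, v) \<in> r" "(a, b) \<in> r"
  shows "I u v = I a b \<longleftrightarrow> u = a \<and> v = b"
  using interval_subset_iff[OF assms(1), of a b] interval_subset_iff[OF assms(2), of u v]
  by (auto intro: antisym)

lemma strict_interval_not_singleton: "(u, v) \<in> strict_pairs \<Longrightarrow> I u v \<noteq> {a}"
  using endpoints_in_interval[of u v] by (auto simp: strict_pairs_def)

text \<open>Splits the vertices of the final complex into original vertices and midpoints.\<close>

lemma intervals_eq:
  "intervals P r = (\<lambda>u. {u}) ` P \<union> (\<lambda>(u, v). I u v) ` strict_pairs" (is "_ = ?R")
proof
  show "intervals P r \<subseteq> ?R"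
  proof
    fix J assume "J \<in> intervals P r"
    then obtain u v where uv: "J = I u v" "u \<in> P" "(u, v) \<in> r" by (auto simp: intervals_def)
    then show "J \<in> ?R"
      by (cases "u = v") (auto simp: interval_self strict_pairs_def)
  qed
  show "?R \<subseteq> intervals P r"
    unfolding intervals_def strict_pairs_def using interval_self refl carrier by fastforce
qed

section \<open>The order complex on singletons\<close>

lemma embedded_order_complex_eq:
  "embedded_order_complex P r = (\<lambda>\<sigma>. (\<lambda>u. {u}) ` \<sigma>) ` order_complex P r"
  unfolding embedded_order_complex_def
  by (intro image_cong) (auto simp: order_complex_def interval_self subset_iff)

lemma vertices_embedded_order_complex:
  "vertices (embedded_order_complex P r) = (\<lambda>u. {u}) ` P"
proof -
  have "{u} \<in> order_complex P r" if "u \<in> P" for u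
    using that by (auto simp: order_complex_def Chains_def refl)
  moreover have "\<sigma> \<subseteq> P" if "\<sigma> \<in> order_complex P r" for \<sigma>
    using that by (simp add: order_complex_def)
  ultimately show ?thesis
    unfolding vertices_def embedded_order_complex_eq by blast
qed

lemma finite_complex_embedded_order_complex: "finite_complex (embedded_order_complex P r)"
  unfolding finite_complex_def
proof (intro conjI ballI allI impI)
  have "finite (order_complex P r)"
    by (rule finite_subset[of _ "Pow P"]) (auto simp: order_complex_def finite)
  then show "finite (embedded_order_complex P r)" by (simp add: embedded_order_complex_eq)
  show "{} \<in> embedded_order_complex P r"
    by (auto simp: embedded_order_complex_eq order_complex_def Chains_def)
next
  fix \<sigma> assume "\<sigma> \<in> embedded_order_complex P r"
  then obtain A where A: "\<sigma> = (\<lambda>u. {u}) ` A" "A \<subseteq> P" "A \<in> Chains r"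
    by (auto simp: embedded_order_complex_eq order_complex_def)
  show "finite \<sigma>" using A finite by (auto intro: finite_subset)
  fix \<tau> assume "\<tau> \<subseteq> \<sigma>"
  then obtain B where B: "B \<subseteq> A" "\<tau> = (\<lambda>u. {u}) ` B" using A by (auto simp: subset_image_iff)
  then have "B \<in> order_complex P r" using A by (auto simp: order_complex_def Chains_def)
  then show "\<tau> \<in> embedded_order_complex P r" using B by (simp add: embedded_order_complex_eq)
qed

lemma edges_embedded_order_complex:
  "edges (embedded_order_complex P r) = (\<lambda>(u, v). {{u}, {v}}) ` strict_pairs" (is "?E = ?R")
proof
  show "?E \<subseteq> ?R"
  proof
    fix e assume "e \<in> ?E"
    then obtain A where A: "e = (\<lambda>u. {u}) ` A" "A \<in> order_complex P r" "card e = 2"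
      by (auto simp: edges_def embedded_order_complex_eq)
    then have "card A = 2" by (simp add: card_image)
    then obtain a b where ab: "A = {a, b}" "a \<noteq> b" by (auto simp: card_2_iff)
    \<comment> \<open>The edge is unordered, so whichever order holds supplies the strict
      pair.\<close>
    then have "(a, b) \<in> strict_pairs \<or> (b, a) \<in> strict_pairs"
      using A(2) by (auto simp: order_complex_def Chains_def strict_pairs_def)
    moreover have "e = {{a}, {b}}" "e = {{b}, {a}}" using A ab by auto
    ultimately show "e \<in> ?R" by auto
  qed
  show "?R \<subseteq> ?E"
  proof
    fix e assume "e \<in> ?R"
    then obtain u v where uv: "e = {{u}, {v}}" "(u, v) \<in> r" "u \<noteq> v"
      by (auto simp: strict_pairs_def)
    then have "{u, v} \<in> order_complex P r"
      using carrier refl by (auto simp: order_complex_def Chains_def)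
    moreover have "e = (\<lambda>u. {u}) ` {u, v}" using uv by simp
    ultimately have "e \<in> embedded_order_complex P r"
      unfolding embedded_order_complex_eq by blast
    then show "e \<in> ?E" using uv by (simp add: edges_def)
  qed
qed

section \<open>The intermediate complexes\<close>

text \<open>The unordered \<open>{J, K}\<close> makes the relation symmetric. Diagonal pairs in
  \<open>r - S\<close> only give \<open>J = K\<close>, which inclusion already covers.\<close>

definition adjacent :: "('a \<times> 'a) set \<Rightarrow> 'a set \<Rightarrow> 'a set \<Rightarrow> bool" where
  "adjacent S J K \<longleftrightarrow> J \<subseteq> K \<or> K \<subseteq> J \<or> (\<exists>(a, b) \<in> r - S. {J, K} = {{a}, {b}})"

text \<open>The complex obtained after subdividing the edges \<open>{u, v}\<close> with \<open>(u, v) \<in> S\<close>.\<close>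

definition stage :: "('a \<times> 'a) set \<Rightarrow> 'a set set set" where
  "stage S = clique_complex ((\<lambda>u. {u}) ` P \<union> (\<lambda>(u, v). I u v) ` S) (adjacent S)"

lemma symp_adjacent: "symp (adjacent S)"
  by (auto simp: symp_def adjacent_def insert_commute)

lemma adjacent_singletons:
  "adjacent S {a} {b} \<longleftrightarrow> a = b \<or> (a, b) \<in> r - S \<or> (b, a) \<in> r - S"
  by (auto simp: adjacent_def doubleton_eq_iff)

lemma adjacent_non_singleton:
  assumes "\<And>a. K \<noteq> {a}"
  shows "adjacent S J K \<longleftrightarrow> J \<subseteq> K \<or> K \<subseteq> J"
  using assms by (auto simp: adjacent_def doubleton_eq_iff)

lemma stage_empty: "stage {} = embedded_order_complex P r"
proof -
  have "\<sigma> \<in> stage {} \<longleftrightarrow> \<sigma> \<in> embedded_order_complex P r" for \<sigma>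
  proof -
    have "\<sigma> \<in> stage {} \<longleftrightarrow> (\<exists>A \<subseteq> P. \<sigma> = (\<lambda>u. {u}) ` A \<and> (\<forall>a\<in>A. \<forall>b\<in>A. adjacent {} {a} {b}))"
      unfolding stage_def clique_complex_def by (auto simp: subset_image_iff)
    also have "\<dots> \<longleftrightarrow> (\<exists>A \<subseteq> P. \<sigma> = (\<lambda>u. {u}) ` A \<and> A \<in> Chains r)"
    proof -
      have "adjacent {} {a} {b} \<longleftrightarrow> (a, b) \<in> r \<or> (b, a) \<in> r" if "a \<in> P" for a b
        using refl[OF that] by (auto simp: adjacent_singletons)
      then have "(\<forall>a\<in>A. \<forall>b\<in>A. adjacent {} {a} {b}) \<longleftrightarrow> A \<in> Chains r" if "A \<subseteq> P" for A
        using that by (simp add: Chains_def subset_iff)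
      then show ?thesis by (intro ex_cong1 conj_cong HOL.refl) simp
    qed
    also have "\<dots> \<longleftrightarrow> \<sigma> \<in> embedded_order_complex P r"
      by (auto simp: embedded_order_complex_eq order_complex_def)
    finally show ?thesis .
  qed
  then show ?thesis by blast
qed

text \<open>Only diagonal pairs are left in \<open>r - strict_pairs\<close>, so adjacency has become
  comparability under inclusion and cliques are chains of intervals.\<close>

lemma stage_strict_pairs: "stage strict_pairs = order_complex (intervals P r) inclusion"
proof -
  have "adjacent strict_pairs J K \<longleftrightarrow> J \<subseteq> K \<or> K \<subseteq> J" for J K
    by (auto simp: adjacent_def strict_pairs_def)
  then show ?thesis
    by (auto simp: stage_def clique_complex_def order_complex_def Chains_def inclusion_def
        intervals_eq)
qed

text \<open>\<open>larger\<close> and \<open>smaller\<close> are what the numbering provides at this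
  moment. The first keeps singletons outside \<open>[u,v]\<close> from being common neighbours; the
  second keeps the edges inside \<open>[u,v]\<close> intact and earlier midpoints out of it.\<close>

lemma stellar_subdivision_stage:
  assumes S: "S \<subseteq> strict_pairs" and uv: "(u, v) \<in> strict_pairs" "(u, v) \<notin> S"
    and larger: "\<And>a b. (a, b) \<in> strict_pairs \<Longrightarrow> I u v \<subset> I a b \<Longrightarrow> (a, b) \<in> S"
    and smaller: "\<And>a b. (a, b) \<in> S \<Longrightarrow> \<not> I a b \<subset> I u v"
  shows "stellar_subdivision {{u}, {v}} (I u v) (stage S) = stage (insert (u, v) S)"
proof -
  let ?V = "(\<lambda>u. {u}) ` P \<union> (\<lambda>(u, v). I u v) ` S"
  let ?R = "adjacent S" and ?R' = "adjacent (insert (u, v) S)"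
  have r: "(u, v) \<in> r" "u \<noteq> v" "u \<in> P" "v \<in> P"
    using uv carrier by (auto simp: strict_pairs_def)
  have Sr: "(a, b) \<in> r" if "(a, b) \<in> S" for a b
    using that S by (auto simp: strict_pairs_def)
  have new: "?R' x (I u v) \<longleftrightarrow> ?R x {u} \<and> ?R x {v}" if "x \<in> ?V" for x
  proof -
    have lhs: "?R' x (I u v) \<longleftrightarrow> x \<subseteq> I u v \<or> I u v \<subseteq> x"
      using strict_interval_not_singleton[OF uv(1)] by (rule adjacent_non_singleton)
    from that consider a where "a \<in> P" "x = {a}" | a b where "(a, b) \<in> S" "x = I a b" by auto
    then show ?thesis
    proof cases
      case 1
      have "?R' x (I u v) \<longleftrightarrow> (u, a) \<in> r \<and> (a, v) \<in> r"
        unfolding lhs using 1 endpoints_in_interval[OF r(1)] r(2) by (auto simp: interval_def)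
      also have "\<dots> \<longleftrightarrow> ?R {a} {u} \<and> ?R {a} {v}"
      proof
        assume a: "(u, a) \<in> r \<and> (a, v) \<in> r"
        \<comment> \<open>Both subintervals are proper unless \<open>a\<close> is an endpoint, so
          \<open>smaller\<close> says that the edges from \<open>a\<close> to \<open>u\<close> and
          \<open>v\<close> are not yet subdivided.\<close>
        have sub: "I u a \<subseteq> I u v" "I a v \<subseteq> I u v"
          using a r refl by (auto simp: interval_subset_iff)
        have "(u, a) \<notin> S" if "a \<noteq> v"
          using smaller[of u a] sub a r interval_inject[of u a u v] that by auto
        moreover have "(a, v) \<notin> S" if "a \<noteq> u"
          using smaller[of a v] sub a r interval_inject[of a v u v] that by auto
        ultimately show "?R {a} {u} \<and> ?R {a} {v}"
          using a r(1) uv(2) unfolding adjacent_singletons by auto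
      next
        assume R: "?R {a} {u} \<and> ?R {a} {v}"
        \<comment> \<open>If \<open>a < u\<close>, the larger interval \<open>[a,v]\<close> was
          treated earlier, so \<open>{a}\<close> and \<open>{v}\<close> are no longer adjacent. The
          case \<open>a > v\<close> is dual, with \<open>[u,a]\<close>.\<close>
        have False if au: "(a, u) \<in> r" "a \<noteq> u"
        proof -
          have av: "(a, v) \<in> r" "a \<noteq> v"
            using au r trans[of a u v] antisym[of u v] by auto
          then have "I u v \<subset> I a v"
            using au r refl interval_inject[of u v a v]
            by (auto simp: psubset_eq interval_subset_iff)
          then have "(a, v) \<in> S" using larger av by (simp add: strict_pairs_def)
          moreover have "(v, a) \<notin> r" using av antisym by blast
          ultimately show False using R av unfolding adjacent_singletons by blast
        qed
        moreover have False if va: "(v, a) \<in> r" "a \<noteq> v"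
        proof -
          have ua: "(u, a) \<in> r" "a \<noteq> u"
            using va r trans[of u v a] antisym[of u v] by auto
          then have "I u v \<subset> I u a"
            using va r refl interval_inject[of u v u a]
            by (auto simp: psubset_eq interval_subset_iff)
          then have "(u, a) \<in> S" using larger ua by (simp add: strict_pairs_def)
          moreover have "(a, u) \<notin> r" using ua antisym by blast
          ultimately show False using R ua unfolding adjacent_singletons by blast
        qed
        ultimately show "(u, a) \<in> r \<and> (a, v) \<in> r"
          using R refl r unfolding adjacent_singletons by blast
      qed
      finally show ?thesis using 1 by simp
    next
      case 2
      have ns: "x \<noteq> {c}" for c
        using strict_interval_not_singleton 2 S by blast
      have ne: "I a b \<noteq> I u v" using 2 uv r Sr interval_inject by blast
      \<comment> \<open>An earlier midpoint lies neither properly inside \<open>[u,v]\<close>, by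
        \<open>smaller\<close>, nor coincides with it, by \<open>ne\<close>.\<close>
      have "?R' x (I u v) \<longleftrightarrow> I u v \<subseteq> x"
        unfolding lhs using smaller[OF 2(1)] ne 2 by auto
      also have "\<dots> \<longleftrightarrow> {u} \<subseteq> x \<and> {v} \<subseteq> x"
        unfolding 2(2) interval_subset_iff[OF r(1)]
        using r trans[of a u v] trans[of u v b] by (auto simp: interval_def)
      also have "\<dots> \<longleftrightarrow> ?R {u} x \<and> ?R {v} x"
      proof -
        \<comment> \<open>A nonempty \<open>x\<close> that is no singleton cannot lie in
          \<open>{u}\<close> or \<open>{v}\<close>, so adjacency to these means containing
          them.\<close>
        have "x \<noteq> {}" using 2 endpoints_in_interval Sr by blast
        then show ?thesis unfolding adjacent_non_singleton[OF ns] using ns by (auto simp: subset_singleton_iff)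
      qed
      also have "\<dots> \<longleftrightarrow> ?R x {u} \<and> ?R x {v}" using symp_adjacent by (meson sympD)
      finally show ?thesis .
    qed
  qed
  \<comment> \<open>By antisymmetry \<open>(v, u)\<close> is not in \<open>r\<close>, so inserting
    \<open>(u, v)\<close> into \<open>S\<close> really removes the edge.\<close>
  have old: "?R' x y \<longleftrightarrow> ?R x y \<and> {x, y} \<noteq> {{u}, {v}}" for x y
    using r(1,2) uv(2) by (auto simp: adjacent_def doubleton_eq_iff dest: antisym)
  have "I u v \<noteq> I a b" if "(a, b) \<in> S" for a b
    using that uv(2) interval_inject[OF r(1) Sr[OF that]] by blast
  then have w: "I u v \<notin> ?V" using strict_interval_not_singleton[OF uv(1)] by auto
  have R: "reflp_on ?V ?R" "?R' (I u v) (I u v)" "?R {u} {v}"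
    using r uv(2) by (auto simp: reflp_on_def adjacent_def)
  have V: "{u} \<in> ?V" "{v} \<in> ?V" "{u} \<noteq> {v}" using r by auto
  have "stellar_subdivision {{u}, {v}} (I u v) (clique_complex ?V ?R)
      = clique_complex (insert (I u v) ?V) ?R'"
    by (rule stellar_subdivision_clique_complex[OF R(1) symp_adjacent symp_adjacent V R(3) w R(2) old new])
  then show ?thesis by (simp add: stage_def)
qed

section \<open>Running through a numbering\<close>

lemma interval_numbering_distinct: "interval_numbering P r uvs \<Longrightarrow> distinct uvs"
  and set_interval_numbering: "interval_numbering P r uvs \<Longrightarrow> set uvs = strict_pairs"
  unfolding interval_numbering_def strict_pairs_def by blast+

text \<open>Induction over prefixes: the order condition at position \<open>k\<close> says that all
  larger intervals are in the prefix and no smaller ones are, as one subdivision step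
  requires.\<close>

lemma fold_stellar_subdivision:
  assumes num: "interval_numbering P r uvs" and "k \<le> length uvs"
  shows "fold (\<lambda>(e, w). stellar_subdivision e w) (map (interval_edge P r) (take k uvs))
      (embedded_order_complex P r) = stage (set (take k uvs))"
  using assms(2)
proof (induction k)
  case 0
  then show ?case by (simp add: stage_empty)
next
  case (Suc k)
  let ?S = "set (take k uvs)"
  obtain u v where k: "uvs ! k = (u, v)" by fastforce
  have lt: "k < length uvs" using Suc.prems by simp
  have dist: "distinct uvs" and set: "set uvs = strict_pairs"
    using num by (rule interval_numbering_distinct, rule set_interval_numbering)
  have ord: "\<And>i j. i < length uvs \<Longrightarrow> j < length uvs \<Longrightarrow>
        I (fst (uvs ! j)) (snd (uvs ! j)) \<subset> I (fst (uvs ! i)) (snd (uvs ! i)) \<Longrightarrow> i < j"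
    using num unfolding interval_numbering_def by blast
  have uv: "(u, v) \<in> strict_pairs" using lt k set nth_mem by metis
  have mem: "p \<in> ?S \<longleftrightarrow> (\<exists>i<k. p = uvs ! i)" for p
    using lt by (auto simp: in_set_conv_nth)
  have S: "?S \<subseteq> strict_pairs" using set set_take_subset by metis
  have "(u, v) \<notin> ?S"
    unfolding mem using dist lt k nth_eq_iff_index_eq by fastforce
  moreover have "(a, b) \<in> ?S" if ab: "(a, b) \<in> strict_pairs" "I u v \<subset> I a b" for a b
  proof -
    obtain i where i: "i < length uvs" "uvs ! i = (a, b)"
      using ab(1) set by (metis in_set_conv_nth)
    then have "i < k" using ord[of i k] lt k ab(2) by simp
    then show ?thesis unfolding mem using i by auto
  qed
  moreover have "\<not> I a b \<subset> I u v" if ab: "(a, b) \<in> ?S" for a b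
  proof
    assume less: "I a b \<subset> I u v"
    obtain i where i: "i < k" "uvs ! i = (a, b)" using ab unfolding mem by auto
    then have "k < i" using ord[of k i] lt k less by simp
    then show False using i by simp
  qed
  ultimately have "stellar_subdivision {{u}, {v}} (I u v) (stage ?S) = stage (insert (u, v) ?S)"
    using stellar_subdivision_stage[OF S uv] by blast
  moreover have "interval_edge P r (u, v) = ({{u}, {v}}, I u v)"
    using uv carrier by (auto simp: interval_edge_def strict_pairs_def interval_self)
  ultimately show ?case
    using Suc.IH lt k by (simp add: take_Suc_conv_app_nth)
qed

text \<open>Antisymmetry recovers the ordered pair from its edge, an interval determines its
  endpoints, and midpoints are not singletons, so they are new vertices.\<close>

lemma edge_numbering_interval_edge:
  assumes "interval_numbering P r uvs"
  shows "edge_numbering (embedded_order_complex P r) (map (interval_edge P r) uvs)"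
proof -
  have dist: "distinct uvs" and set: "set uvs = strict_pairs"
    using assms by (rule interval_numbering_distinct, rule set_interval_numbering)
  have ie: "interval_edge P r p = (case p of (u, v) \<Rightarrow> ({{u}, {v}}, I u v))"
    if "p \<in> strict_pairs" for p
    using that carrier by (auto simp: interval_edge_def strict_pairs_def interval_self)
  have fst: "map fst (map (interval_edge P r) uvs) = map (\<lambda>(u, v). {{u}, {v}}) uvs"
    and snd: "map snd (map (interval_edge P r) uvs) = map (\<lambda>(u, v). I u v) uvs"
    using ie set by (auto simp: split_beta)
  have "inj_on (\<lambda>(u, v). {{u}, {v}}) strict_pairs"
    by (auto simp: inj_on_def strict_pairs_def doubleton_eq_iff dest: antisym)
  moreover have "inj_on (\<lambda>(u, v). I u v) strict_pairs"
    by (auto simp: inj_on_def strict_pairs_def interval_inject)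
  ultimately show ?thesis
    unfolding edge_numbering_def fst snd edges_embedded_order_complex
      vertices_embedded_order_complex distinct_map
    using dist set strict_interval_not_singleton by auto
qed

section \<open>Links of the original vertices\<close>

text \<open>\<open>{x}\<close> is minimal among the nonempty intervals, so those comparable with it
  and different from it are the ones properly containing it.\<close>

lemma link_singleton:
  assumes "x \<in> P"
  shows "link (order_complex (intervals P r) inclusion) {{x}} =
    order_complex {J \<in> intervals P r. {x} \<subset> J} inclusion" (is "?L = ?R")
proof
  have ne: "J \<noteq> {}" if "J \<in> intervals P r" for J
    using that endpoints_in_interval by (auto simp: intervals_def)
  show "?L \<subseteq> ?R"
  proof
    fix \<tau> assume "\<tau> \<in> ?L"
    then obtain \<sigma> where \<sigma>: "\<tau> = \<sigma> - {{x}}" "{x} \<in> \<sigma>"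
      "\<sigma> \<in> order_complex (intervals P r) inclusion"
      unfolding link_def by blast
    then have chain: "\<sigma> \<subseteq> intervals P r" "\<And>J K. J \<in> \<sigma> \<Longrightarrow> K \<in> \<sigma> \<Longrightarrow> J \<subseteq> K \<or> K \<subseteq> J"
      by (auto simp: order_complex_def Chains_def inclusion_def)
    have "{x} \<subset> J" if "J \<in> \<tau>" for J
      using chain(2)[of J "{x}"] chain(1) \<sigma>(1,2) ne[of J] that by auto
    then show "\<tau> \<in> ?R"
      using \<sigma>(1) chain by (auto simp: order_complex_def Chains_def inclusion_def)
  qed
  show "?R \<subseteq> ?L"
  proof
    fix \<tau> assume \<tau>: "\<tau> \<in> ?R"
    have "{x} \<in> intervals P r" using assms by (simp add: intervals_eq)
    then have "insert {x} \<tau> \<in> order_complex (intervals P r) inclusion"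
      using \<tau> by (auto simp: order_complex_def Chains_def inclusion_def)
    moreover have "\<tau> = insert {x} \<tau> - {{x}}" using \<tau> by (auto simp: order_complex_def)
    ultimately show "\<tau> \<in> ?L" unfolding link_def by blast
  qed
qed

text \<open>The bijection \<open>u\<close> to \<open>{u}\<close> matches the index sets, so
  multiplicities agree even where different vertices have equal links.\<close>

lemma image_order_complex_interval_transform2:
  "image_mset (\<lambda>Q. order_complex Q inclusion) (interval_transform2 P r) =
    vertex_links (embedded_order_complex P r) (order_complex (intervals P r) inclusion)"
proof -
  have "mset_set (vertices (embedded_order_complex P r)) = image_mset (\<lambda>u. {u}) (mset_set P)"
    by (simp add: vertices_embedded_order_complex image_mset_mset_set)
  then show ?thesis
    by (auto simp: vertex_links_def interval_transform2_def multiset.map_comp finite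
        interval_self link_singleton intro!: image_mset_cong)
qed

text \<open>Sorting by decreasing cardinality works because proper inclusion of finite intervals
  lowers the cardinality; the sign in \<open>f\<close> turns the ascending sort around.\<close>

lemma interval_numbering_exists: "\<exists>uvs. interval_numbering P r uvs"
proof -
  obtain xs where xs: "set xs = strict_pairs" "distinct xs"
    using finite_distinct_list[OF finite_strict_pairs] by blast
  define f where "f p = - int (card (I (fst p) (snd p)))" for p
  let ?uvs = "sort_key f xs"
  have "i < j" if "i < length ?uvs" "j < length ?uvs"
    "I (fst (?uvs ! j)) (snd (?uvs ! j)) \<subset> I (fst (?uvs ! i)) (snd (?uvs ! i))" for i j
  proof (rule ccontr)
    assume "\<not> i < j"
    then have "f (?uvs ! j) \<le> f (?uvs ! i)"
      using sorted_nth_mono[OF sorted_sort_key[of f xs], of j i] that(1,2) by simp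
    moreover have "finite (I (fst (?uvs ! i)) (snd (?uvs ! i)))"
      using finite by (simp add: interval_def)
    ultimately show False using psubset_card_mono[OF _ that(3)] by (simp add: f_def)
  qed
  then have "interval_numbering P r ?uvs"
    using xs by (simp add: interval_numbering_def strict_pairs_def)
  then show ?thesis by blast
qed

end

text \<open>The existence clause keeps the statement about all numberings from being
  vacuous.\<close>

theorem corollary5p2:
  fixes P :: "'a set" and r :: "'a rel"
  assumes "finite P" and "partial_order_on P r"
  shows "(\<exists>uvs. interval_numbering P r uvs) \<and>
    (\<forall>uvs. interval_numbering P r uvs \<longrightarrow>
       tchebyshev_second
         (embedded_order_complex P r)
         (map (interval_edge P r) uvs)
         (order_complex (intervals P r) inclusion)
         (image_mset (\<lambda>Q. order_complex Q inclusion) (interval_transform2 P r)))"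
proof -
  interpret finite_poset P r using assms by unfold_locales
  have "order_complex (intervals P r) inclusion =
      fold (\<lambda>(e, w). stellar_subdivision e w) (map (interval_edge P r) uvs)
        (embedded_order_complex P r)" if num: "interval_numbering P r uvs" for uvs
  proof -
    show ?thesis
      \<comment> \<open>\<open>order_refl\<close> sets \<open>k = length uvs\<close>, so the prefix
        is the whole list and every strict pair has been subdivided.\<close>
      using fold_stellar_subdivision[OF num order_refl]
      by (simp add: set_interval_numbering[OF num] stage_strict_pairs)
  qed
  then show ?thesis
    using interval_numbering_exists finite_complex_embedded_order_complex
      edge_numbering_interval_edge image_order_complex_interval_transform2
    by (simp add: tchebyshev_second_def tchebyshev_first_def)
qed

end
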